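(* Let $F$ be a CNF formula over $n$ Boolean variables with set of satisfying assignments $S=S(F)\subseteq\{0,1\}^n$, let $i\ge0$, let $\mathcal{D}_i$ be any $i$-uniform distribution on subsets of $\{0,1\}^n$, and let $\theta>0$. Consider the procedure: set $t=\lceil 8\ln(1/\theta)\rceil$, $Z=0$, $j=0$; while $j<t$ and $Z<2t$: sample $R_j\sim\mathcal{D}_i$ independently of all previous samples, set $Y_j=\min\{4,|S\cap R_j|\}$, $Z\leftarrow Z+Y_j$, $j\leftarrow j+1$. Finally, if $Z/t\ge2$ output ``I believe that $|S|\ge 2^i$'', otherwise output ``Don't know''. Then the output is incorrect with probability at most $\theta$; that is, the probability that the procedure outputs ``I believe that $|S|\ge2^i$'' while in fact $|S|<2^i$ is at most $\theta$.
   Context: A distribution $\mathcal{D}$ on subsets of $\{0,1\}^n$ is $i$-uniform if, for $R\sim\mathcal{D}$, $\Pr[\sigma\in R]=2^{-i}$ for every $\sigma\in\{0,1\}^n$. *)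

theory Defs
  imports "HOL-Probability.Probability"
begin

datatype literal = Pos nat | Neg nat

primrec var :: "literal \<Rightarrow> nat" where
  "var (Pos v) = v"
| "var (Neg v) = v"

type_synonym clause = "literal list"
type_synonym cnf = "clause list"

text \<open>Variables are numbered from \<open>0\<close> to \<open>n - 1\<close>, and they need not all occur in the formula.\<close>

definition cnf_over :: "nat \<Rightarrow> cnf \<Rightarrow> bool" where
  "cnf_over n F \<longleftrightarrow> (\<forall>C \<in> set F. \<forall>l \<in> set C. var l < n)"

definition cube :: "nat \<Rightarrow> bool list set" where
  "cube n = {\<sigma>. length \<sigma> = n}"

primrec lit_holds :: "bool list \<Rightarrow> literal \<Rightarrow> bool" where
  "lit_holds \<sigma> (Pos v) \<longleftrightarrow> \<sigma> ! v"
| "lit_holds \<sigma> (Neg v) \<longleftrightarrow> \<not> \<sigma> ! v"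

definition satisfies :: "bool list \<Rightarrow> cnf \<Rightarrow> bool" where
  "satisfies \<sigma> F \<longleftrightarrow> (\<forall>C \<in> set F. \<exists>l \<in> set C. lit_holds \<sigma> l)"

definition sat_assignments :: "nat \<Rightarrow> cnf \<Rightarrow> bool list set" where
  "sat_assignments n F = {\<sigma> \<in> cube n. satisfies \<sigma> F}"

text \<open>There are only finitely many subsets of the cube, so every probability distribution on
  them is a probability mass function.\<close>

definition i_uniform :: "nat \<Rightarrow> nat \<Rightarrow> bool list set pmf \<Rightarrow> bool" where
  "i_uniform n i D \<longleftrightarrow>
     set_pmf D \<subseteq> Pow (cube n) \<and>
     (\<forall>\<sigma> \<in> cube n. measure_pmf.prob D {R. \<sigma> \<in> R} = 1 / 2 ^ i)"

text \<open>The while loop started in state \<open>(j, Z)\<close>, as the distribution of the final value of \<open>Z\<close>.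
  Every iteration binds a new sample from \<open>D\<close>, which makes it independent of the earlier ones.\<close>

function loop :: "'a set \<Rightarrow> 'a set pmf \<Rightarrow> int \<Rightarrow> nat \<Rightarrow> nat \<Rightarrow> nat pmf" where
  "loop S D t j Z =
     (if int j < t \<and> int Z < 2 * t
      then bind_pmf D (\<lambda>R. loop S D t (Suc j) (Z + min 4 (card (S \<inter> R))))
      else return_pmf Z)"
  by pat_completeness auto
termination
  by (relation "Wellfounded.measure (\<lambda>(S, D, t, j, Z). nat (t - int j))") auto

declare loop.simps [simp del]

text \<open>\<open>Believe_card_ge m\<close> is the answer that the formula has at least \<open>m\<close> satisfying assignments.\<close>

datatype answer = Believe_card_ge nat | Dont_know

text \<open>For \<open>\<theta> \<ge> 1\<close> we have \<open>t \<le> 0\<close>: the loop body is never executed, and as \<open>0 / t = 0\<close>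
  (also for \<open>t = 0\<close>) the answer is \<open>Dont_know\<close>.\<close>

definition procedure :: "nat \<Rightarrow> cnf \<Rightarrow> nat \<Rightarrow> bool list set pmf \<Rightarrow> real \<Rightarrow> answer pmf" where
  "procedure n F i D \<theta> =
     (let t = \<lceil>8 * ln (1 / \<theta>)\<rceil> in
      map_pmf (\<lambda>Z. if real Z / of_int t \<ge> 2 then Believe_card_ge (2 ^ i) else Dont_know)
        (loop (sat_assignments n F) D t 0 0))"

end

theory Submission
  imports Defs
begin

text \<open>A step of the loop adds \<open>Y \<in> {0, \<dots>, 4}\<close> with \<open>E Y \<le> |S| / 2 ^ i \<le> 1\<close>. Put \<open>w = 3 powr (1 / 4)\<close>.
  By convexity \<open>w ^ y \<le> 1 + y / 2\<close> on \<open>{0, \<dots>, 4}\<close>, so \<open>E (w ^ Y) \<le> 3 / 2\<close>. Hence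
  \<open>(3 / 2) ^ (t - j) * w ^ Z / w ^ (2 * t)\<close> is a supermartingale along the loop. It is at least \<open>1\<close> whenever the
  loop stops with \<open>Z \<ge> 2 * t\<close>, so that event has probability at most its initial value
  \<open>(sqrt 3 / 2) ^ t \<le> exp (- t / 8) \<le> \<theta>\<close>. Being a supermartingale argument, this is
  unaffected by the early exit of the loop.\<close>

lemma integrable_measure_pmf_bounded:
  fixes f :: "'a \<Rightarrow> real"
  assumes "\<And>x. \<bar>f x\<bar> \<le> B"
  shows "integrable (measure_pmf D) f"
  by (rule measure_pmf.integrable_const_bound[where B = B]) (use assms in auto)

lemma prob_bind_pmf:
  "measure_pmf.prob (bind_pmf D f) A = measure_pmf.expectation D (\<lambda>x. measure_pmf.prob (f x) A)"
  unfolding measure_pmf_bind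
  by (rule measure_pmf.measure_bind[where N = "count_space UNIV"])
    (use measurable_measure_pmf[of f] in auto)

text \<open>The right side is the chord of \<open>w ^ k\<close> through \<open>k = 0\<close> and
  \<open>k = 4\<close>, with equality at both ends. Taking fourth powers removes the root and leaves
  five rational inequalities.\<close>

lemma fourth_root_three_power_le:
  fixes w :: real
  assumes "w > 0" "w ^ 4 = 3" "k \<le> 4"
  shows "w ^ k \<le> 1 + real k / 2"
proof (rule power_le_imp_le_base)
  have "(w ^ k) ^ Suc 3 = (w ^ 4) ^ k"
    by (simp flip: power_mult add: mult.commute)
  also have "\<dots> = 3 ^ k" using assms by simp
  also have "3 ^ k \<le> (1 + real k / 2) ^ Suc 3"
  proof -
    have "k \<in> {0, 1, 2, 3, 4}" using assms by auto
    then show ?thesis by (auto simp: power_divide eval_nat_numeral)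
  qed
  finally show "(w ^ k) ^ Suc 3 \<le> (1 + real k / 2) ^ Suc 3" .
qed simp

text \<open>Linearity of expectation over membership indicators; only one-point marginals of
  \<open>D\<close> enter.\<close>

lemma expectation_card_Int:
  fixes p :: real
  assumes "finite S" "\<And>\<sigma>. \<sigma> \<in> S \<Longrightarrow> measure_pmf.prob D {R. \<sigma> \<in> R} = p"
  shows "measure_pmf.expectation D (\<lambda>R. real (card (S \<inter> R))) = card S * p"
proof -
  have "real (card (S \<inter> R)) = (\<Sum>\<sigma>\<in>S. indicator {R. \<sigma> \<in> R} R)" for R
    using assms(1) by (simp add: indicator_def sum.If_cases Int_def)
  then have "measure_pmf.expectation D (\<lambda>R. real (card (S \<inter> R))) =
    (\<Sum>\<sigma>\<in>S. measure_pmf.expectation D (indicator {R. \<sigma> \<in> R}))"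
    by (simp add: Bochner_Integration.integral_sum integrable_measure_pmf_bounded[where B = 1])
  also have "\<dots> = card S * p"
    using assms(2) by simp
  finally show ?thesis .
qed

text \<open>Truncation keeps the exponent in the range of the chord bound; dropping it afterwards
  only enlarges the linear upper bound.\<close>

lemma expectation_power_truncated_card_le:
  fixes w :: real
  assumes "w > 0" "w ^ 4 = 3" "finite S"
    and "measure_pmf.expectation D (\<lambda>R. real (card (S \<inter> R))) \<le> 1"
  shows "measure_pmf.expectation D (\<lambda>R. w ^ min 4 (card (S \<inter> R))) \<le> 3 / 2"
proof -
  have int: "integrable D (\<lambda>R. real (card (S \<inter> R)))"
    by (rule integrable_measure_pmf_bounded[where B = "card S"]) (use assms(3) in \<open>simp add: card_mono\<close>)
  have le: "w ^ min 4 (card (S \<inter> R)) \<le> 1 + real (card (S \<inter> R)) / 2" for R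
    using fourth_root_three_power_le[OF assms(1,2), of "min 4 (card (S \<inter> R))"] by auto
  have "measure_pmf.expectation D (\<lambda>R. w ^ min 4 (card (S \<inter> R)))
      \<le> measure_pmf.expectation D (\<lambda>R. 1 + real (card (S \<inter> R)) / 2)"
  proof (rule integral_mono[OF integrable_measure_pmf_bounded[where B = 3]])
    fix R
    show "\<bar>w ^ min 4 (card (S \<inter> R))\<bar> \<le> 3"
      using fourth_root_three_power_le[OF assms(1,2), of "min 4 (card (S \<inter> R))"] assms(1) by auto
  qed (use int le in auto)
  also have "\<dots> = 1 + measure_pmf.expectation D (\<lambda>R. real (card (S \<inter> R))) / 2"
    using int by simp
  finally show ?thesis using assms(4) by simp
qed

text \<open>The supermartingale bound, by induction on the remaining iterations
  \<open>T - j\<close>. The state \<open>(j, Z)\<close> is arbitrary because an iteration moves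
  \<open>Z\<close> by a random amount.\<close>

lemma prob_loop_ge_le:
  fixes w :: real
  assumes w: "w \<ge> 1"
    and E: "measure_pmf.expectation D (\<lambda>R. w ^ min 4 (card (S \<inter> R))) \<le> c" and "c \<ge> 1"
  shows "j \<le> T \<Longrightarrow> measure_pmf.prob (loop S D (int T) j Z) {2 * T..} \<le> c ^ (T - j) * w ^ Z / w ^ (2 * T)"
proof (induction "T - j" arbitrary: j Z)
  case 0
  then have "loop S D (int T) j Z = return_pmf Z" "T = j"
    by (simp_all add: loop.simps[of S D _ j Z])
  then show ?case using w
    by (cases "Z < 2 * T") (auto simp: divide_simps power_increasing)
next
  case (Suc k)
  then have k: "k = T - Suc j" "Suc j \<le> T" and c: "c ^ (T - j) = c * c ^ k"
    using Suc.hyps(2)[symmetric] by auto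
  let ?Y = "\<lambda>R. min 4 (card (S \<inter> R))"
  show ?case
  proof (cases "Z < 2 * T")
    case False
    \<comment> \<open>Early exit: the factors \<open>c\<close> of the skipped iterations are at
      least 1, so the claimed bound is at least 1.\<close>
    have "1 * w ^ (2 * T) \<le> c ^ (T - j) * w ^ Z"
      using False w \<open>c \<ge> 1\<close> by (intro mult_mono one_le_power power_increasing) auto
    then show ?thesis
      using w False by (simp add: loop.simps[of S D "int T" j Z] divide_simps)
  next
    case True
    have "measure_pmf.prob (loop S D (int T) j Z) {2 * T..} =
        measure_pmf.expectation D (\<lambda>R. measure_pmf.prob (loop S D (int T) (Suc j) (Z + ?Y R)) {2 * T..})"
      using True k by (simp add: loop.simps[of S D "int T" j Z] prob_bind_pmf)
    \<comment> \<open>The induction hypothesis at each successor state splits into a factor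
      independent of \<open>R\<close> and \<open>w ^ ?Y R\<close>, whose mean supplies the missing
      factor \<open>c\<close>.\<close>
    also have "\<dots> \<le> measure_pmf.expectation D (\<lambda>R. c ^ k * w ^ Z / w ^ (2 * T) * w ^ ?Y R)"
    proof (rule integral_mono)
      show "integrable D (\<lambda>R. measure_pmf.prob (loop S D (int T) (Suc j) (Z + ?Y R)) {2 * T..})"
        by (rule integrable_measure_pmf_bounded[where B = 1]) simp
      show "integrable D (\<lambda>R. c ^ k * w ^ Z / w ^ (2 * T) * w ^ ?Y R)"
        using w by (intro integrable_mult_right integrable_measure_pmf_bounded[where B = "w ^ 4"])
          (auto intro: power_increasing)
      show "measure_pmf.prob (loop S D (int T) (Suc j) (Z + ?Y R)) {2 * T..}
          \<le> c ^ k * w ^ Z / w ^ (2 * T) * w ^ ?Y R" for R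
        using Suc.hyps(1)[OF k, of "Z + ?Y R"] k by (simp add: power_add mult_ac)
    qed
    also have "\<dots> = c ^ k * w ^ Z / w ^ (2 * T) * measure_pmf.expectation D (\<lambda>R. w ^ ?Y R)"
      by simp
    also have "\<dots> \<le> c ^ k * w ^ Z / w ^ (2 * T) * c"
      using E w \<open>c \<ge> 1\<close> by (intro mult_left_mono) auto
    finally show ?thesis by (simp add: c mult_ac)
  qed
qed

lemma finite_sat_assignments: "finite (sat_assignments n F)"
  unfolding sat_assignments_def cube_def
  using finite_lists_length_eq[of "UNIV :: bool set" n] by simp

theorem theorem1:
  fixes n i :: nat and F :: cnf and D :: "bool list set pmf" and \<theta> :: real
  assumes "cnf_over n F"
    and "i_uniform n i D"
    and "\<theta> > 0"
  shows "measure_pmf.prob (procedure n F i D \<theta>)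
           {a. a = Believe_card_ge (2 ^ i) \<and> card (sat_assignments n F) < 2 ^ i} \<le> \<theta>"
proof (cases "card (sat_assignments n F) < 2 ^ i")
  case False
  then show ?thesis using \<open>\<theta> > 0\<close> by simp
next
  case True
  define S t T where "S = sat_assignments n F" and "t = \<lceil>8 * ln (1 / \<theta>)\<rceil>" and "T = nat t"
  have event: "measure_pmf.prob (procedure n F i D \<theta>)
      {a. a = Believe_card_ge (2 ^ i) \<and> card (sat_assignments n F) < 2 ^ i}
    = measure_pmf.prob (loop S D t 0 0) {Z. real Z / of_int t \<ge> 2}"
    using True by (simp add: procedure_def Let_def S_def t_def vimage_def)
  show ?thesis
  proof (cases "t > 0")
    case False
    then show ?thesis
      unfolding event using \<open>\<theta> > 0\<close> by (simp add: loop.simps[of S D t])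
  next
    case True
    then have t: "t = int T" "T > 0" by (auto simp: T_def)
    then have set_eq: "{Z. real Z / of_int t \<ge> 2} = {2 * T..}"
      by (auto simp: field_simps simp flip: of_nat_mult)
    have S: "finite S" "card S < 2 ^ i"
      using finite_sat_assignments \<open>card (sat_assignments n F) < 2 ^ i\<close> by (auto simp: S_def)
    \<comment> \<open>Nested square roots make \<open>w ^ 2 = sqrt 3\<close> available, which later
      turns \<open>(3 / 2) / w ^ 2\<close> into \<open>sqrt 3 / 2\<close>.\<close>
    define w :: real where "w = sqrt (sqrt 3)"
    have w2: "w ^ 2 = sqrt 3" and w: "w \<ge> 1"
      by (auto simp: w_def)
    have w4: "w ^ 4 = 3"
      using power_mult[of w 2 2] w2 by simp
    have "measure_pmf.expectation D (\<lambda>R. real (card (S \<inter> R))) = card S * (1 / 2 ^ i)"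
      using assms(2) S(1)
      by (intro expectation_card_Int) (auto simp: i_uniform_def S_def sat_assignments_def)
    also have "\<dots> \<le> 1"
      using S(2) by (simp flip: of_nat_power)
    finally have "measure_pmf.expectation D (\<lambda>R. w ^ min 4 (card (S \<inter> R))) \<le> 3 / 2"
      using w w4 S(1) by (intro expectation_power_truncated_card_le) auto
    from prob_loop_ge_le[OF w this, of 0 T 0]
    have "measure_pmf.prob (loop S D t 0 0) {2 * T..} \<le> (3 / 2) ^ T / w ^ (2 * T)"
      by (simp add: t)
    also have "\<dots> = (sqrt 3 / 2) ^ T"
      by (simp add: power_mult w2 real_div_sqrt flip: power_divide divide_divide_eq_left')
    also have "\<dots> \<le> exp (- 1 / 8) ^ T"
    proof (rule power_mono)
      \<comment> \<open>Squared, this is \<open>3 / 4 = 1 - 1 / 4 \<le> exp (- 1 / 4)\<close>; the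
        resulting rate \<open>1 / 8\<close> matches the constant 8 in \<open>t\<close>.\<close>
      have "(sqrt 3 / 2) ^ 2 \<le> exp (- 1 / 8 :: real) ^ 2"
        using exp_ge_add_one_self[of "- 1 / 4 :: real"]
        by (simp add: power_divide flip: exp_of_nat_mult)
      then show "sqrt 3 / 2 \<le> exp (- 1 / 8 :: real)"
        by (rule power2_le_imp_le) simp
    qed simp
    also have "\<dots> = exp (- real T / 8)"
      by (simp flip: exp_of_nat_mult)
    also have "\<dots> \<le> exp (ln \<theta>)"
    proof -
      \<comment> \<open>Rounding up only increases \<open>t\<close>, hence only lowers the
        exponential bound.\<close>
      have "8 * ln (1 / \<theta>) \<le> of_int t" by (simp add: t_def)
      then have "- real T / 8 \<le> ln \<theta>" using \<open>\<theta> > 0\<close> t by (simp add: ln_div)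
      then show ?thesis by (simp only: exp_le_cancel_iff)
    qed
    finally show ?thesis unfolding event set_eq using \<open>\<theta> > 0\<close> by simp
  qed
qed

end
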